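(* Let $\mathcal I=[0,b)$, $X=\{x_n\}_{n=1}^\infty$, $d_n=x_n-x_{n-1}$ with $\sup_nd_n<\infty$, and $\alpha=\{\alpha_n\}_{n=1}^\infty\subset\mathbb R$ be as in the context. The Hamiltonian $\mathrm H_{X,\alpha}$ is semibounded below whenever $$\inf_{n\in\mathbb N}\frac{\alpha_n}{d_n+d_{n+1}}>-\infty .$$
   Context: Let $\mathcal I=[0,b)$, $0<b\le+\infty$, and $X=\{x_n\}_{n=1}^\infty$, $x_0=0$, with $0=x_0<x_1<x_2<\dots<b$ and $\lim_nx_n=b$; $d_n=x_n-x_{n-1}$, and $d^*=\sup_nd_n<\infty$ is assumed. $W^{2,2}(\mathcal I\setminus X)=\{f\in L^2(\mathcal I): f,f'\in AC_{loc}(\mathcal I\setminus X),\ f''\in L^2(\mathcal I)\}$, and $W^{2,2}_{\mathrm{comp}}(\mathcal I\setminus X)$ is the set of its elements whose support is compact in $\mathcal I=[0,b)$. $\mathrm H_{X,\alpha}$ is the closure in $L^2(\mathcal I)$ of the symmetric operator $-\mathrm d^2/\mathrm dx^2$ with domain $$\{f\in W^{2,2}_{\mathrm{comp}}(\mathcal I\setminus X): f'(0)=0,\ f(x_n+)=f(x_n-),\ f'(x_n+)-f'(x_n-)=\alpha_nf(x_n),\ n\in\mathbb N\}.$$ A symmetric operator $T$ is semibounded below if $(Tf,f)\ge c\|f\|^2$ for all $f\in\operatorname{dom}(T)$ with some $c\in\mathbb R$. *)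

theory Defs
  imports "HOL-Analysis.Analysis"
begin

section \<open>The Hilbert space of square integrable functions\<close>

text \<open>
  Elements of \<open>L\<^sup>2(I)\<close> are handled through representatives \<open>real \<Rightarrow> complex\<close>; the values of a
  representative outside \<open>I\<close> are irrelevant, and representatives that agree almost everywhere on
  \<open>I\<close> are at distance zero from each other.
\<close>

definition L2 :: "real set \<Rightarrow> (real \<Rightarrow> complex) set" where
  "L2 I = {f \<in> borel_measurable (lebesgue_on I). integrable (lebesgue_on I) (\<lambda>t. (cmod (f t))\<^sup>2)}"

definition L2_inner :: "real set \<Rightarrow> (real \<Rightarrow> complex) \<Rightarrow> (real \<Rightarrow> complex) \<Rightarrow> complex" where
  "L2_inner I f g = (LINT t|lebesgue_on I. f t * cnj (g t))"

definition L2_norm :: "real set \<Rightarrow> (real \<Rightarrow> complex) \<Rightarrow> real" where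
  "L2_norm I f = sqrt (LINT t|lebesgue_on I. (cmod (f t))\<^sup>2)"


section \<open>Operators given by their graphs\<close>

text \<open>
  An operator \<open>T\<close> in \<open>L\<^sup>2(I)\<close> is represented by its graph, the set of pairs \<open>(f, g)\<close> of representatives
  with \<open>T f = g\<close> in \<open>L\<^sup>2(I)\<close>. The closure of an operator is then the closure of its graph in
  \<open>L\<^sup>2(I) \<times> L\<^sup>2(I)\<close>.
\<close>

type_synonym l2_graph = "((real \<Rightarrow> complex) \<times> (real \<Rightarrow> complex)) set"

definition graph_closure :: "real set \<Rightarrow> l2_graph \<Rightarrow> l2_graph" where
  "graph_closure I T = {(f, g). f \<in> L2 I \<and> g \<in> L2 I \<and>
     (\<exists>F G. (\<forall>k::nat. (F k, G k) \<in> T) \<and>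
            (\<lambda>k. L2_norm I (\<lambda>t. F k t - f t)) \<longlonglongrightarrow> 0 \<and>
            (\<lambda>k. L2_norm I (\<lambda>t. G k t - g t)) \<longlonglongrightarrow> 0)}"

text \<open>
  The inequality \<open>(T f, f) \<ge> c \<parallel>f\<parallel>\<^sup>2\<close> is one between reals, so it includes that the
  complex number \<open>(T f, f)\<close> is real.
\<close>

definition semibounded_below :: "real set \<Rightarrow> l2_graph \<Rightarrow> bool" where
  "semibounded_below I T \<longleftrightarrow>
     (\<exists>c::real. \<forall>(f, g) \<in> T. L2_inner I g f \<in> \<real> \<and> Re (L2_inner I g f) \<ge> c * (L2_norm I f)\<^sup>2)"


section \<open>Local absolute continuity and Sobolev functions\<close>

definition AC_on :: "real \<Rightarrow> real \<Rightarrow> (real \<Rightarrow> complex) \<Rightarrow> bool" where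
  "AC_on u v f \<longleftrightarrow>
     (\<forall>\<epsilon>>0. \<exists>\<delta>>0. \<forall>\<D> T. \<D> division_of T \<and> T \<subseteq> {u..v} \<and> (\<Sum>K\<in>\<D>. Sup K - Inf K) < \<delta> \<longrightarrow>
        (\<Sum>K\<in>\<D>. cmod (f (Sup K) - f (Inf K))) < \<epsilon>)"

definition AC_loc :: "real set \<Rightarrow> (real \<Rightarrow> complex) \<Rightarrow> bool" where
  "AC_loc S f \<longleftrightarrow> (\<forall>u v. u \<le> v \<and> {u..v} \<subseteq> S \<longrightarrow> AC_on u v f)"

text \<open>
  \<open>W22 I X f f' f''\<close>: the function \<open>f\<close> belongs to \<open>W\<^sup>2\<^sup>,\<^sup>2(I - X)\<close> with first derivative \<open>f'\<close> and
  second derivative \<open>f''\<close>. As \<open>f'\<close> is (locally absolutely) continuous, it is the classical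
  derivative of \<open>f\<close> at every point of \<open>I - X\<close> (one-sided at an endpoint belonging to \<open>I - X\<close>), whereas
  \<open>f''\<close> is the almost everywhere derivative of \<open>f'\<close>. Values at the points of \<open>X\<close> play no role.
\<close>

definition W22 ::
  "real set \<Rightarrow> real set \<Rightarrow> (real \<Rightarrow> complex) \<Rightarrow> (real \<Rightarrow> complex) \<Rightarrow> (real \<Rightarrow> complex) \<Rightarrow> bool" where
  "W22 I X f f' f'' \<longleftrightarrow>
     f \<in> L2 I \<and> AC_loc (I - X) f \<and> AC_loc (I - X) f' \<and> f'' \<in> L2 I \<and>
     (\<forall>t\<in>I - X. (f has_vector_derivative f' t) (at t within (I - X))) \<and>
     (AE t in lebesgue_on I. (f' has_vector_derivative f'' t) (at t within (I - X)))"

text \<open>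
  The support is closed up in \<open>\<real>\<close>, so for it to be compact in \<open>I\<close> it must also be contained in \<open>I\<close>.
\<close>

definition compact_support_in :: "real set \<Rightarrow> real set \<Rightarrow> (real \<Rightarrow> complex) \<Rightarrow> bool" where
  "compact_support_in I X f \<longleftrightarrow>
     compact (closure {t \<in> I - X. f t \<noteq> 0}) \<and> closure {t \<in> I - X. f t \<noteq> 0} \<subseteq> I"


section \<open>The Hamiltonian with delta-interactions\<close>

definition interval_I :: "ereal \<Rightarrow> real set" where
  "interval_I b = {t. 0 \<le> t \<and> ereal t < b}"

definition interaction_points :: "(nat \<Rightarrow> real) \<Rightarrow> real set" where
  "interaction_points x = x ` {1..}"

text \<open>Only used for \<open>n \<ge> 1\<close>.\<close>

definition gap :: "(nat \<Rightarrow> real) \<Rightarrow> nat \<Rightarrow> real" where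
  "gap x n = x n - x (n - 1)"

text \<open>
  In the condition at \<open>x\<^sub>n\<close>, the number \<open>l\<close> is the common one-sided limit \<open>f(x\<^sub>n+) = f(x\<^sub>n-)\<close>, which is
  what \<open>f(x\<^sub>n)\<close> stands for, and \<open>p\<close>, \<open>m\<close> are \<open>f'(x\<^sub>n+)\<close>, \<open>f'(x\<^sub>n-)\<close>.
\<close>

definition delta_condition ::
  "(real \<Rightarrow> complex) \<Rightarrow> (real \<Rightarrow> complex) \<Rightarrow> real \<Rightarrow> real \<Rightarrow> bool" where
  "delta_condition f f' y a \<longleftrightarrow>
     (\<exists>l p m. (f \<longlongrightarrow> l) (at_right y) \<and> (f \<longlongrightarrow> l) (at_left y) \<and>
              (f' \<longlongrightarrow> p) (at_right y) \<and> (f' \<longlongrightarrow> m) (at_left y) \<and>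
              p - m = of_real a * l)"

definition minimal_graph :: "ereal \<Rightarrow> (nat \<Rightarrow> real) \<Rightarrow> (nat \<Rightarrow> real) \<Rightarrow> l2_graph" where
  "minimal_graph b x \<alpha> = {(f, g). \<exists>f' f''.
     W22 (interval_I b) (interaction_points x) f f' f'' \<and>
     compact_support_in (interval_I b) (interaction_points x) f \<and>
     f' 0 = 0 \<and> (\<forall>n\<ge>1. delta_condition f f' (x n) (\<alpha> n)) \<and>
     g = (\<lambda>t. - f'' t)}"

definition Hamiltonian :: "ereal \<Rightarrow> (nat \<Rightarrow> real) \<Rightarrow> (nat \<Rightarrow> real) \<Rightarrow> l2_graph" where
  "Hamiltonian b x \<alpha> = graph_closure (interval_I b) (minimal_graph b x \<alpha>)"

end

theory Submission
  imports Defs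
begin

text \<open>
  Semiboundedness passes to the closure, so consider \<open>f\<close> in the minimal domain. Integration by parts on
  each cell of length \<open>d\<^sub>n\<close> turns the quadratic form into \<open>\<parallel>f'\<parallel>\<^sup>2 + \<Sum> \<alpha>\<^sub>n \<bar>f(x\<^sub>n)\<bar>\<^sup>2\<close>. For
  every \<open>\<eta> > 0\<close> an endpoint value \<open>z\<close> of \<open>f\<close> on a cell satisfies
  \<open>d\<^sub>n \<bar>z\<bar>\<^sup>2 \<le> (1 + d\<^sub>n\<^sup>2 / \<eta>) \<parallel>f\<parallel>\<^sup>2 + \<eta> \<parallel>f'\<parallel>\<^sup>2\<close> (norms over the cell). Since
  \<open>\<alpha>\<^sub>n \<ge> - C (d\<^sub>n + d\<^sub>n\<^sub>+\<^sub>1)\<close> and the lengths are bounded, a small \<open>\<eta>\<close> lets \<open>\<parallel>f'\<parallel>\<^sup>2\<close> absorb the derivative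
  part of the interaction terms.
\<close>


section \<open>Absolutely continuous functions\<close>

lemma AC_onE:
  assumes "AC_on a b f" "\<epsilon> > 0"
  obtains \<delta> where "\<delta> > 0"
    "\<And>\<D> T. \<lbrakk>\<D> division_of T; T \<subseteq> {a..b}; (\<Sum>K\<in>\<D>. Sup K - Inf K) < \<delta>\<rbrakk>
       \<Longrightarrow> (\<Sum>K\<in>\<D>. cmod (f (Sup K) - f (Inf K))) < \<epsilon>"
proof -
  obtain \<delta> where "\<delta> > 0" and \<delta>:
    "\<forall>\<D> T. \<D> division_of T \<and> T \<subseteq> {a..b} \<and> (\<Sum>K\<in>\<D>. Sup K - Inf K) < \<delta> \<longrightarrow>
        (\<Sum>K\<in>\<D>. cmod (f (Sup K) - f (Inf K))) < \<epsilon>"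
    using assms(1)[unfolded AC_on_def, rule_format, OF assms(2)] by (elim exE conjE)
  show thesis
    by (rule that[OF \<open>\<delta> > 0\<close> \<delta>[rule_format]]) (intro conjI)
qed

lemma sum_length_tagged_partial_division_le:
  fixes q :: "(real \<times> real set) set"
  assumes q: "q tagged_partial_division_of {a..b}"
    and U: "U \<in> lmeasurable" and sub: "\<And>t K. (t, K) \<in> q \<Longrightarrow> K \<subseteq> U"
  shows "(\<Sum>K\<in>snd ` q. Sup K - Inf K) \<le> measure lebesgue U"
proof -
  have div: "snd ` q division_of \<Union>(snd ` q)"
    using q by (rule partial_division_of_tagged_division)
  have len: "Sup K - Inf K = measure lebesgue K" if K: "K \<in> snd ` q" for K
  proof -
    obtain c d where "K = cbox c d" "K \<noteq> {}"
      using division_ofD(3)[OF div K] division_ofD(4)[OF div K] by blast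
    then show ?thesis by auto
  qed
  have "(\<Sum>K\<in>snd ` q. Sup K - Inf K) = (\<Sum>K\<in>snd ` q. measure lebesgue K)"
    using len by (intro sum.cong) auto
  also have "\<dots> = measure lebesgue (\<Union>(snd ` q))"
    using div by (rule content_division)
  also have "\<dots> \<le> measure lebesgue U"
  proof (rule measure_mono_fmeasurable)
    show "\<Union>(snd ` q) \<subseteq> U"
      using sub by (force simp: image_iff)
    show "\<Union>(snd ` q) \<in> sets lebesgue"
      using lmeasurable_division[OF div] by (rule fmeasurableD)
  qed (rule U)
  finally show ?thesis .
qed

text \<open>Two tags can share an interval only if its interior is empty. Such an interval is a
  single point, where the increment of \<open>f\<close> vanishes, so forgetting the tags changes
  nothing.\<close>

lemma sum_tagged_partial_division_image:
  fixes f :: "real \<Rightarrow> 'a::real_normed_vector"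
  assumes q: "q tagged_partial_division_of {a..b}"
  shows "(\<Sum>(t,K)\<in>q. norm (f (Sup K) - f (Inf K))) = (\<Sum>K\<in>snd ` q. norm (f (Sup K) - f (Inf K)))"
proof -
  have "(\<Sum>K\<in>snd ` q. norm (f (Sup K) - f (Inf K))) = (\<Sum>z\<in>q. norm (f (Sup (snd z)) - f (Inf (snd z))))"
  proof (subst sum.reindex_nontrivial)
    show "finite q"
      using q by (simp add: tagged_partial_division_of_def)
    fix z w assume zw: "z \<in> q" "w \<in> q" "z \<noteq> w" "snd z = snd w"
    obtain s K where z: "z = (s, K)" by fastforce
    obtain t where w: "w = (t, K)" using zw z by (cases w) auto
    have "interior K = {}"
      using tagged_partial_division_ofD(5)[OF q, of s K t K] zw z w by auto
    moreover obtain c d where K: "K = cbox c d" "s \<in> K"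
      using tagged_partial_division_ofD(2,4)[OF q, of s K] zw z by auto
    ultimately have "c = d"
      by (auto simp: box_eq_empty)
    then show "norm (f (Sup (snd z)) - f (Inf (snd z))) = 0"
      using z K by simp
  qed (simp add: o_def)
  then show ?thesis
    by (simp add: case_prod_beta)
qed

text \<open>
  Tags outside the exceptional null set contribute as in the usual gauge proof; the
  intervals tagged in the null set are forced into an open set of small measure, where absolute
  continuity bounds the increments of \<open>f\<close>.
\<close>

theorem AC_on_fundamental_theorem:
  assumes "a \<le> b" and ac: "AC_on a b f" and neg: "negligible E"
    and deriv: "\<And>t. t \<in> {a..b} - E \<Longrightarrow> (f has_vector_derivative g t) (at t within {a..b})"
  shows "(g has_integral (f b - f a)) {a..b}"
proof -
  \<comment> \<open>Nothing is known about \<open>g\<close> on \<open>E\<close>. With value 0 there,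
    a term tagged in \<open>E\<close> reduces to an increment of \<open>f\<close>.\<close>
  define g0 where "g0 = (\<lambda>t. if t \<in> E then 0 else g t)"
  have "(g0 has_integral (f b - f a)) {a..b}"
    unfolding has_integral_real
  proof (intro allI impI)
    fix e :: real assume "e > 0"
    \<comment> \<open>The summand 1 keeps the denominator positive for \<open>a = b\<close> and
      makes the bound by \<open>e / 2\<close> strict.\<close>
    define e1 where "e1 = e / (2 * (b - a + 1))"
    have e1: "e1 > 0" "e1 * (b - a) < e / 2"
      using \<open>e > 0\<close> \<open>a \<le> b\<close> by (auto simp: e1_def field_simps)
    obtain \<delta> where "\<delta> > 0" and \<delta>:
      "\<And>\<D> T. \<lbrakk>\<D> division_of T; T \<subseteq> {a..b}; (\<Sum>K\<in>\<D>. Sup K - Inf K) < \<delta>\<rbrakk>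
         \<Longrightarrow> (\<Sum>K\<in>\<D>. cmod (f (Sup K) - f (Inf K))) < e / 2"
      by (fact AC_onE[OF ac half_gt_zero[OF \<open>e > 0\<close>]])
    have Enull: "E \<in> null_sets lebesgue"
      using neg negligible_iff_null_sets by blast
    then obtain U where U: "open U" "E \<subseteq> U" "U - E \<in> lmeasurable" "emeasure lebesgue (U - E) < ennreal \<delta>"
      using sets_lebesgue_outer_open[OF _ \<open>\<delta> > 0\<close>] by blast
    \<comment> \<open>Outer approximation controls only \<open>U - E\<close>; putting the null set
      \<open>E\<close> back preserves the bound on the measure.\<close>
    have "U = (U - E) \<union> E"
      using U by blast
    have Ulm: "U \<in> lmeasurable"
      using U Enull by (metis \<open>U = U - E \<union> E\<close> fmeasurable.Un fmeasurableI_null_sets)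
    have "emeasure lebesgue U < ennreal \<delta>"
      using U(4) Enull \<open>U = U - E \<union> E\<close> by (metis U(3) emeasure_Un_null_set fmeasurableD)
    then have mU: "measure lebesgue U < \<delta>"
      using Ulm \<open>\<delta> > 0\<close> by (simp add: emeasure_eq_measure2 ennreal_less_iff)
    \<comment> \<open>Radius of the gauge at \<open>t\<close>: off \<open>E\<close> it makes the
      linear approximation of \<open>f\<close> accurate up to \<open>e1\<close>, on \<open>E\<close>
      it keeps the ball inside \<open>U\<close>.\<close>
    have "\<exists>d>0. (t \<in> {a..b} - E \<longrightarrow>
         (\<forall>y\<in>{a..b}. \<bar>y-t\<bar> < d \<longrightarrow> norm (f y - f t - (y-t) *\<^sub>R g t) \<le> e1 * \<bar>y-t\<bar>)) \<and>
         (t \<in> E \<longrightarrow> ball t d \<subseteq> U)" for t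
    proof (cases "t \<in> E")
      case True
      then show ?thesis
        using U(1,2) open_contains_ball by blast
    next
      case False
      show ?thesis
      proof (cases "t \<in> {a..b}")
        case True
        with False deriv[of t] e1(1) show ?thesis
          unfolding has_vector_derivative_def has_derivative_within_alt real_norm_def by (metis DiffI)
      next
        case False
        then show ?thesis using \<open>t \<notin> E\<close> zero_less_one by blast
      qed
    qed
    then obtain d where d0: "\<And>t. d t > 0"
      and d1: "\<And>t y. \<lbrakk>t \<in> {a..b}; t \<notin> E; y \<in> {a..b}; \<bar>y-t\<bar> < d t\<rbrakk>
                \<Longrightarrow> norm (f y - f t - (y-t) *\<^sub>R g t) \<le> e1 * \<bar>y-t\<bar>"
      and d2: "\<And>t. t \<in> E \<Longrightarrow> ball t (d t) \<subseteq> U"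
      by (metis DiffI)
    show "\<exists>\<gamma>. gauge \<gamma> \<and> (\<forall>\<D>. \<D> tagged_division_of {a..b} \<and> \<gamma> fine \<D> \<longrightarrow>
            norm ((\<Sum>(x, k)\<in>\<D>. measure lborel k *\<^sub>R g0 x) - (f b - f a)) < e)"
    proof (intro exI conjI allI impI; (elim conjE)?)
      show "gauge (\<lambda>t. ball t (d t))"
        using d0 gauge_ball_dependent by blast
      fix p assume p: "p tagged_division_of {a..b}" and fine: "(\<lambda>t. ball t (d t)) fine p"
      have fin: "finite p" using p by blast
      define q where "q = {z \<in> p. fst z \<in> E}"
      have q: "q tagged_partial_division_of {a..b}"
        using p tagged_partial_division_subset[of p "{a..b}" q]
        by (auto simp: q_def tagged_division_of_def)
      define r where "r = (\<lambda>z. measure lborel (snd z) *\<^sub>R g0 (fst z) - (f (Sup (snd z)) - f (Inf (snd z))))"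
      have len: "(\<Sum>z\<in>p. Sup (snd z) - Inf (snd z)) = b - a"
        using additive_tagged_division_1[OF \<open>a \<le> b\<close> p, of "\<lambda>x. x"] by (simp add: case_prod_beta)
      have incr: "(\<Sum>z\<in>p. f (Sup (snd z)) - f (Inf (snd z))) = f b - f a"
        using additive_tagged_division_1[OF \<open>a \<le> b\<close> p, of f] by (simp add: case_prod_beta)
      have tag: "\<exists>u v. K = {u..v} \<and> u \<le> t \<and> t \<le> v \<and> a \<le> u \<and> v \<le> b \<and> t - u < d t \<and> v - t < d t"
        if tK: "(t, K) \<in> p" for t K
      proof -
        obtain u v where K: "K = cbox u v"
          using tagged_division_ofD(4)[OF p tK] by blast
        have "t \<in> K" "K \<subseteq> {a..b}" "K \<subseteq> ball t (d t)"
          using tagged_division_ofD(2,3)[OF p tK] fine tK by (auto dest: fineD)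
        moreover from this have "u \<in> K" "v \<in> K"
          using K by auto
        then have "u \<in> ball t (d t)" "v \<in> ball t (d t)"
          using \<open>K \<subseteq> ball t (d t)\<close> by blast+
        ultimately show ?thesis
          unfolding K by (intro exI[of _ u] exI[of _ v]) (auto simp: dist_real_def)
      qed
      have good: "norm (r z) \<le> e1 * (Sup (snd z) - Inf (snd z))" if "z \<in> p - q" for z
      proof -
        obtain t K where z: "z = (t, K)" by fastforce
        with that have tE: "t \<notin> E" and tK: "(t, K) \<in> p" by (auto simp: q_def)
        obtain u v where K: "K = {u..v}" "u \<le> t" "t \<le> v" "a \<le> u" "v \<le> b" "t - u < d t" "v - t < d t"
          using tag[OF tK] by blast
        \<comment> \<open>Straddling: both ends of the interval are compared with the tangent at the
          tag \<open>t\<close> between them, so the distances in the two errors add up to its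
          length.\<close>
        have "r z = (f u - f t - (u-t) *\<^sub>R g t) - (f v - f t - (v-t) *\<^sub>R g t)"
          using tE K by (simp add: z r_def g0_def algebra_simps)
        also have "norm \<dots> \<le> e1 * \<bar>u-t\<bar> + e1 * \<bar>v-t\<bar>"
          using K tE by (intro order_trans[OF norm_triangle_ineq4] add_mono d1) auto
        also have "\<dots> = e1 * (Sup K - Inf K)"
          using K by (simp add: algebra_simps)
        finally show ?thesis by (simp add: z)
      qed
      have "norm (\<Sum>z\<in>p-q. r z) \<le> (\<Sum>z\<in>p-q. e1 * (Sup (snd z) - Inf (snd z)))"
        using good by (rule sum_norm_le)
      also have "\<dots> \<le> (\<Sum>z\<in>p. e1 * (Sup (snd z) - Inf (snd z)))"
      proof (rule sum_mono2[OF fin])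
        fix z assume "z \<in> p - (p - q)"
        then show "0 \<le> e1 * (Sup (snd z) - Inf (snd z))"
          using tag[of "fst z" "snd z"] e1(1) by auto
      qed auto
      also have "\<dots> = e1 * (b - a)"
        using len by (simp flip: sum_distrib_left)
      finally have A: "norm (\<Sum>z\<in>p-q. r z) < e / 2"
        using e1(2) by simp
      have KU: "K \<subseteq> U" if "(t, K) \<in> q" for t K
        using that fineD[OF fine, of t K] d2[of t] by (auto simp: q_def)
      have "\<Union>(snd ` q) \<subseteq> {a..b}"
        using tagged_partial_division_ofD(3)[OF q] by force
      then have B0: "(\<Sum>K\<in>snd ` q. cmod (f (Sup K) - f (Inf K))) < e / 2"
        using order_le_less_trans[OF sum_length_tagged_partial_division_le[OF q Ulm] mU] KU
        by (intro \<delta>[OF partial_division_of_tagged_division[OF q]]) blast+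
      have "norm (\<Sum>z\<in>q. r z) \<le> (\<Sum>z\<in>q. norm (f (Sup (snd z)) - f (Inf (snd z))))"
        by (rule sum_norm_le) (simp add: r_def q_def g0_def norm_minus_commute)
      also have "\<dots> < e / 2"
        using B0 sum_tagged_partial_division_image[OF q, of f] by (simp add: case_prod_beta)
      finally have B: "norm (\<Sum>z\<in>q. r z) < e / 2" .
      have "(\<Sum>z\<in>p. r z) = (\<Sum>z\<in>p-q. r z) + (\<Sum>z\<in>q. r z)"
        by (rule sum.subset_diff) (auto simp: q_def fin)
      then have "norm (\<Sum>z\<in>p. r z) < e"
        using A B norm_triangle_ineq[of "\<Sum>z\<in>p-q. r z" "\<Sum>z\<in>q. r z"] by simp
      then show "norm ((\<Sum>(x, k)\<in>p. measure lborel k *\<^sub>R g0 x) - (f b - f a)) < e"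
        by (simp add: r_def sum_subtractf incr[unfolded sum_subtractf] case_prod_beta)
    qed
  qed
  then show ?thesis
    by (rule has_integral_spike[OF neg, rotated]) (simp add: g0_def)
qed

section \<open>Continuity and products of absolutely continuous functions\<close>

lemma AC_on_imp_continuous_on:
  assumes "AC_on a b f"
  shows "continuous_on {a..b} f"
  unfolding continuous_on_iff
proof (intro ballI allI impI)
  fix s e :: real assume s: "s \<in> {a..b}" and "e > 0"
  obtain \<delta> where "\<delta> > 0" and \<delta>:
    "\<And>\<D> T. \<lbrakk>\<D> division_of T; T \<subseteq> {a..b}; (\<Sum>K\<in>\<D>. Sup K - Inf K) < \<delta>\<rbrakk>
       \<Longrightarrow> (\<Sum>K\<in>\<D>. cmod (f (Sup K) - f (Inf K))) < e"
    by (fact AC_onE[OF assms \<open>e > 0\<close>])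
  \<comment> \<open>A division with one interval already bounds the increment between two nearby
    points.\<close>
  have *: "cmod (f v - f u) < e" if "a \<le> u" "u \<le> v" "v \<le> b" "v - u < \<delta>" for u v
    using \<delta>[of "{{u..v}}" "{u..v}"] that division_of_self[of u v] by auto
  show "\<exists>d>0. \<forall>t\<in>{a..b}. dist t s < d \<longrightarrow> dist (f t) (f s) < e"
  proof (intro exI[of _ \<delta>] conjI ballI impI \<open>\<delta> > 0\<close>)
    fix t assume "t \<in> {a..b}" "dist t s < \<delta>"
    then show "dist (f t) (f s) < e"
      using s *[of s t] *[of t s] by (cases "s \<le> t") (auto simp: dist_norm norm_minus_commute abs_if)
  qed
qed

lemma AC_on_cnj: "AC_on a b f \<Longrightarrow> AC_on a b (\<lambda>t. cnj (f t))"
  unfolding AC_on_def by (simp flip: complex_cnj_diff)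

text \<open>Both factors are bounded on the compact interval, and the increment of the product
  splits into one increment of each factor times a bounded value. Integration by parts applies this
  to \<open>f'\<close> and the conjugate of \<open>f\<close>.\<close>

lemma AC_on_mult:
  assumes f: "AC_on a b f" and g: "AC_on a b g"
  shows "AC_on a b (\<lambda>t. f t * g t)"
  unfolding AC_on_def
proof (intro allI impI)
  fix e :: real assume "e > 0"
  have "bounded (f ` {a..b})" "bounded (g ` {a..b})"
    using AC_on_imp_continuous_on[OF f] AC_on_imp_continuous_on[OF g]
    by (auto intro!: compact_imp_bounded compact_continuous_image)
  then obtain Bf Bg where Bf: "Bf > 0" "\<And>t. t \<in> {a..b} \<Longrightarrow> cmod (f t) \<le> Bf"
    and Bg: "Bg > 0" "\<And>t. t \<in> {a..b} \<Longrightarrow> cmod (g t) \<le> Bg"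
    unfolding bounded_pos by blast
  have e: "e / (2 * Bg) > 0" "e / (2 * Bf) > 0"
    using \<open>e > 0\<close> Bf(1) Bg(1) by auto
  obtain \<delta>f where "\<delta>f > 0" and \<delta>f:
    "\<And>\<D> T. \<lbrakk>\<D> division_of T; T \<subseteq> {a..b}; (\<Sum>K\<in>\<D>. Sup K - Inf K) < \<delta>f\<rbrakk>
       \<Longrightarrow> (\<Sum>K\<in>\<D>. cmod (f (Sup K) - f (Inf K))) < e / (2 * Bg)"
    by (fact AC_onE[OF f e(1)])
  obtain \<delta>g where "\<delta>g > 0" and \<delta>g:
    "\<And>\<D> T. \<lbrakk>\<D> division_of T; T \<subseteq> {a..b}; (\<Sum>K\<in>\<D>. Sup K - Inf K) < \<delta>g\<rbrakk>
       \<Longrightarrow> (\<Sum>K\<in>\<D>. cmod (g (Sup K) - g (Inf K))) < e / (2 * Bf)"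
    by (fact AC_onE[OF g e(2)])
  show "\<exists>\<delta>>0. \<forall>\<D> T. \<D> division_of T \<and> T \<subseteq> {a..b} \<and> (\<Sum>K\<in>\<D>. Sup K - Inf K) < \<delta> \<longrightarrow>
      (\<Sum>K\<in>\<D>. cmod (f (Sup K) * g (Sup K) - f (Inf K) * g (Inf K))) < e"
  proof (intro exI[of _ "min \<delta>f \<delta>g"] conjI allI impI; (elim conjE)?)
    show "min \<delta>f \<delta>g > 0" using \<open>\<delta>f > 0\<close> \<open>\<delta>g > 0\<close> by simp
    fix \<D> T assume D: "\<D> division_of T" "T \<subseteq> {a..b}" and small: "(\<Sum>K\<in>\<D>. Sup K - Inf K) < min \<delta>f \<delta>g"
    have "cmod (f (Sup K) * g (Sup K) - f (Inf K) * g (Inf K))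
            \<le> Bf * cmod (g (Sup K) - g (Inf K)) + Bg * cmod (f (Sup K) - f (Inf K))" if K: "K \<in> \<D>" for K
    proof -
      obtain u v where "K = cbox u v" "K \<noteq> {}"
        using division_ofD(3)[OF D(1) K] division_ofD(4)[OF D(1) K] by blast
      then have "Sup K \<in> K" "Inf K \<in> K"
        by auto
      then have mem: "Sup K \<in> {a..b}" "Inf K \<in> {a..b}"
        using division_ofD(2)[OF D(1) K] D(2) by auto
      have "f (Sup K) * g (Sup K) - f (Inf K) * g (Inf K)
            = f (Sup K) * (g (Sup K) - g (Inf K)) + g (Inf K) * (f (Sup K) - f (Inf K))"
        by (simp add: algebra_simps)
      also have "cmod \<dots> \<le> cmod (f (Sup K)) * cmod (g (Sup K) - g (Inf K)) + cmod (g (Inf K)) * cmod (f (Sup K) - f (Inf K))"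
        by (metis norm_mult norm_triangle_ineq)
      also have "\<dots> \<le> Bf * cmod (g (Sup K) - g (Inf K)) + Bg * cmod (f (Sup K) - f (Inf K))"
        using mem Bf Bg by (intro add_mono mult_right_mono) auto
      finally show ?thesis .
    qed
    then have "(\<Sum>K\<in>\<D>. cmod (f (Sup K) * g (Sup K) - f (Inf K) * g (Inf K)))
        \<le> Bf * (\<Sum>K\<in>\<D>. cmod (g (Sup K) - g (Inf K))) + Bg * (\<Sum>K\<in>\<D>. cmod (f (Sup K) - f (Inf K)))"
      by (simp add: sum_mono sum_distrib_left flip: sum.distrib)
    also have "\<dots> < Bf * (e / (2 * Bf)) + Bg * (e / (2 * Bg))"
      using \<delta>f[OF D] \<delta>g[OF D] small Bf(1) Bg(1) by (intro add_strict_mono mult_strict_left_mono) auto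
    also have "\<dots> = e"
      using Bf(1) Bg(1) by simp
    finally show "(\<Sum>K\<in>\<D>. cmod (f (Sup K) * g (Sup K) - f (Inf K) * g (Inf K))) < e" .
  qed
qed


section \<open>Square integrable functions and closures of operators\<close>

lemma L2_norm_power2: "(L2_norm I f)\<^sup>2 = (LINT t|lebesgue_on I. (cmod (f t))\<^sup>2)"
  by (simp add: L2_norm_def)

lemma L2_norm_nonneg [simp]: "L2_norm I f \<ge> 0"
  by (simp add: L2_norm_def)

lemma L2_inner_self: "L2_inner I f f = of_real ((L2_norm I f)\<^sup>2)"
  by (simp add: L2_inner_def L2_norm_power2 complex_norm_square[symmetric] del: of_real_power)

lemma L2_diff:
  assumes "f \<in> L2 I" "g \<in> L2 I"
  shows "(\<lambda>t. f t - g t) \<in> L2 I"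
proof -
  have "integrable (lebesgue_on I) (\<lambda>t. (cmod (f t - g t))\<^sup>2)"
  proof (rule Bochner_Integration.integrable_bound)
    show "integrable (lebesgue_on I) (\<lambda>t. 2 * (cmod (f t))\<^sup>2 + 2 * (cmod (g t))\<^sup>2)"
      using assms by (auto simp: L2_def)
    have "(cmod (z - w))\<^sup>2 \<le> 2 * (cmod z)\<^sup>2 + 2 * (cmod w)\<^sup>2" for z w
    proof -
      have "(cmod (z - w))\<^sup>2 \<le> (cmod z + cmod w)\<^sup>2"
        by (simp add: norm_triangle_ineq4)
      also have "\<dots> \<le> 2 * (cmod z)\<^sup>2 + 2 * (cmod w)\<^sup>2"
        using sum_squares_bound[of "cmod z" "cmod w"] by (simp add: power2_sum)
      finally show ?thesis .
    qed
    then show "AE t in lebesgue_on I. norm ((cmod (f t - g t))\<^sup>2) \<le> norm (2 * (cmod (f t))\<^sup>2 + 2 * (cmod (g t))\<^sup>2)"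
      by auto
  qed (use assms in \<open>auto simp: L2_def\<close>)
  with assms show ?thesis
    by (auto simp: L2_def)
qed

lemma L2_uminus: "f \<in> L2 I \<Longrightarrow> (\<lambda>t. - f t) \<in> L2 I"
  by (auto simp: L2_def)

lemma L2_mult_cnj_integrable:
  assumes "f \<in> L2 I" "g \<in> L2 I"
  shows "integrable (lebesgue_on I) (\<lambda>t. f t * cnj (g t))"
proof (rule Bochner_Integration.integrable_bound)
  show "integrable (lebesgue_on I) (\<lambda>t. (cmod (f t))\<^sup>2 + (cmod (g t))\<^sup>2)"
    using assms by (auto simp: L2_def)
  have "cmod z * cmod w \<le> (cmod z)\<^sup>2 + (cmod w)\<^sup>2" for z w
    using sum_squares_bound[of "cmod z" "cmod w"] mult_nonneg_nonneg[OF norm_ge_zero[of z] norm_ge_zero[of w]] by linarith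
  then show "AE t in lebesgue_on I. norm (f t * cnj (g t)) \<le> norm ((cmod (f t))\<^sup>2 + (cmod (g t))\<^sup>2)"
    by (simp add: norm_mult)
  show "(\<lambda>t. f t * cnj (g t)) \<in> borel_measurable (lebesgue_on I)"
  proof (rule borel_measurable_times)
    have "cnj \<in> borel_measurable borel"
      by (intro borel_measurable_continuous_onI continuous_intros)
    then show "(\<lambda>t. cnj (g t)) \<in> borel_measurable (lebesgue_on I)"
      using assms by (auto simp: L2_def intro: measurable_compose)
  qed (use assms in \<open>simp add: L2_def\<close>)
qed

text \<open>Pointwise, the product is bounded by a weighted sum of squares, with weights chosen so
  that the integrated bound is the product of the norms. Adding \<open>e > 0\<close> to each norm
  avoids division by zero; then \<open>e\<close> tends to 0.\<close>

lemma L2_inner_Cauchy_Schwarz: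
  assumes f: "f \<in> L2 I" and g: "g \<in> L2 I"
  shows "cmod (L2_inner I f g) \<le> L2_norm I f * L2_norm I g"
proof -
  have int: "integrable (lebesgue_on I) (\<lambda>t. (cmod (f t))\<^sup>2)" "integrable (lebesgue_on I) (\<lambda>t. (cmod (g t))\<^sup>2)"
    using f g by (auto simp: L2_def)
  have bound: "cmod (L2_inner I f g) \<le> (L2_norm I f + e) * (L2_norm I g + e)" if "e > 0" for e
  proof -
    define a b where "a = L2_norm I f + e" and "b = L2_norm I g + e"
    have ab: "a > 0" "b > 0" "L2_norm I f \<le> a" "L2_norm I g \<le> b"
      using \<open>e > 0\<close> by (auto simp: a_def b_def add_nonneg_pos)
    have "cmod (L2_inner I f g) \<le> (LINT t|lebesgue_on I. cmod (f t * cnj (g t)))"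
      unfolding L2_inner_def by (rule integral_norm_bound)
    also have "\<dots> \<le> (LINT t|lebesgue_on I. (b/a) * (cmod (f t))\<^sup>2 / 2 + (a/b) * (cmod (g t))\<^sup>2 / 2)"
    proof (rule integral_mono)
      show "integrable (lebesgue_on I) (\<lambda>t. cmod (f t * cnj (g t)))"
        using L2_mult_cnj_integrable[OF f g] by (rule integrable_norm)
      show "integrable (lebesgue_on I) (\<lambda>t. (b/a) * (cmod (f t))\<^sup>2 / 2 + (a/b) * (cmod (g t))\<^sup>2 / 2)"
        using int by auto
      fix t
      have "0 \<le> (b * cmod (f t) - a * cmod (g t))\<^sup>2 / (2 * a * b)"
        using ab by simp
      also have "\<dots> = (b/a) * (cmod (f t))\<^sup>2 / 2 + (a/b) * (cmod (g t))\<^sup>2 / 2 - cmod (f t) * cmod (g t)"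
        using ab by (simp add: field_simps power2_eq_square)
      finally show "cmod (f t * cnj (g t)) \<le> (b/a) * (cmod (f t))\<^sup>2 / 2 + (a/b) * (cmod (g t))\<^sup>2 / 2"
        by (simp add: norm_mult)
    qed
    also have "\<dots> = (b/a) * (L2_norm I f)\<^sup>2 / 2 + (a/b) * (L2_norm I g)\<^sup>2 / 2"
      using int by (simp add: L2_norm_power2)
    also have "\<dots> \<le> (b/a) * a\<^sup>2 / 2 + (a/b) * b\<^sup>2 / 2"
      using ab by (intro add_mono divide_right_mono mult_left_mono power_mono) auto
    also have "\<dots> = a * b"
      using ab by (simp add: power2_eq_square)
    finally show ?thesis by (simp add: a_def b_def)
  qed
  have "((\<lambda>e. (L2_norm I f + e) * (L2_norm I g + e)) \<longlongrightarrow> (L2_norm I f + 0) * (L2_norm I g + 0)) (at_right 0)"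
    by (intro tendsto_intros)
  moreover have "eventually (\<lambda>e. cmod (L2_inner I f g) \<le> (L2_norm I f + e) * (L2_norm I g + e)) (at_right 0)"
    using bound by (auto simp: eventually_at_filter)
  ultimately show ?thesis
    using tendsto_lowerbound[of _ _ "at_right (0::real)"] by fastforce
qed

text \<open>With errors \<open>u\<close> and \<open>v\<close>, sesquilinearity writes the difference
  of the inner products as three terms, each containing an error factor, and Cauchy-Schwarz sends
  each of them to 0.\<close>

lemma tendsto_L2_inner:
  assumes f: "f \<in> L2 I" and g: "g \<in> L2 I" and F: "\<And>k::nat. F k \<in> L2 I" and G: "\<And>k. G k \<in> L2 I"
    and limF: "(\<lambda>k. L2_norm I (\<lambda>t. F k t - f t)) \<longlonglongrightarrow> 0"
    and limG: "(\<lambda>k. L2_norm I (\<lambda>t. G k t - g t)) \<longlonglongrightarrow> 0"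
  shows "(\<lambda>k. L2_inner I (G k) (F k)) \<longlonglongrightarrow> L2_inner I g f"
proof (rule LIM_zero_cancel, rule Lim_null_comparison)
  define u v where "u = (\<lambda>k t. F k t - f t)" and "v = (\<lambda>k t. G k t - g t)"
  have u: "u k \<in> L2 I" and v: "v k \<in> L2 I" for k
    unfolding u_def v_def by (intro L2_diff f g F G)+
  let ?B = "\<lambda>k. L2_norm I (v k) * L2_norm I (u k) + L2_norm I (v k) * L2_norm I f + L2_norm I g * L2_norm I (u k)"
  have "cmod (L2_inner I (G k) (F k) - L2_inner I g f) \<le> ?B k" for k
  proof -
    have "L2_inner I (G k) (F k) - L2_inner I g f = (LINT t|lebesgue_on I. G k t * cnj (F k t) - g t * cnj (f t))"
      unfolding L2_inner_def using f g F G by (simp add: L2_mult_cnj_integrable)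
    also have "\<dots> = (LINT t|lebesgue_on I. v k t * cnj (u k t) + v k t * cnj (f t) + g t * cnj (u k t))"
      by (rule arg_cong[where f = "integral\<^sup>L _"]) (auto simp: u_def v_def algebra_simps)
    also have "\<dots> = L2_inner I (v k) (u k) + L2_inner I (v k) f + L2_inner I g (u k)"
      unfolding L2_inner_def using f g u v by (simp add: L2_mult_cnj_integrable)
    also have "cmod \<dots> \<le> ?B k"
      using f g u v by (intro order_trans[OF norm_triangle_ineq] add_mono L2_inner_Cauchy_Schwarz)
    finally show ?thesis .
  qed
  then show "\<forall>\<^sub>F k in sequentially. cmod (L2_inner I (G k) (F k) - L2_inner I g f) \<le> ?B k"
    by simp
  show "?B \<longlonglongrightarrow> 0"
    using limF limG unfolding u_def v_def by (auto intro!: tendsto_eq_intros)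
qed

text \<open>The form and the squared norm converge along an approximating sequence. The reals are
  closed in the complex plane and weak inequalities survive limits, so the same \<open>c\<close>
  serves for the closure.\<close>

lemma semibounded_below_graph_closure:
  assumes L2: "T \<subseteq> L2 I \<times> L2 I" and "semibounded_below I T"
  shows "semibounded_below I (graph_closure I T)"
proof -
  obtain c where c: "\<And>f g. (f, g) \<in> T \<Longrightarrow> L2_inner I g f \<in> \<real> \<and> Re (L2_inner I g f) \<ge> c * (L2_norm I f)\<^sup>2"
    using assms(2) unfolding semibounded_below_def by blast
  have "L2_inner I g f \<in> \<real> \<and> Re (L2_inner I g f) \<ge> c * (L2_norm I f)\<^sup>2"
    if "(f, g) \<in> graph_closure I T" for f g
  proof -
    obtain F G where f: "f \<in> L2 I" and g: "g \<in> L2 I" and FG: "\<And>k::nat. (F k, G k) \<in> T"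
      and limF: "(\<lambda>k. L2_norm I (\<lambda>t. F k t - f t)) \<longlonglongrightarrow> 0"
      and limG: "(\<lambda>k. L2_norm I (\<lambda>t. G k t - g t)) \<longlonglongrightarrow> 0"
      using \<open>(f, g) \<in> graph_closure I T\<close> unfolding graph_closure_def by blast
    have F: "F k \<in> L2 I" and G: "G k \<in> L2 I" for k
      using FG[of k] L2 by auto
    have lim: "(\<lambda>k. L2_inner I (G k) (F k)) \<longlonglongrightarrow> L2_inner I g f"
      using tendsto_L2_inner[OF f g F G limF limG] .
    have "(\<lambda>k. L2_inner I (F k) (F k)) \<longlonglongrightarrow> L2_inner I f f"
      using tendsto_L2_inner[OF f f F F limF limF] .
    from tendsto_Re[OF this] have limN: "(\<lambda>k. c * (L2_norm I (F k))\<^sup>2) \<longlonglongrightarrow> c * (L2_norm I f)\<^sup>2"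
      unfolding L2_inner_self Re_complex_of_real by (rule tendsto_mult_left)
    have "L2_inner I g f \<in> \<real>"
      using closed_sequentially[OF closed_complex_Reals _ lim] c[OF FG] by blast
    moreover have "c * (L2_norm I f)\<^sup>2 \<le> Re (L2_inner I g f)"
      using LIMSEQ_le[OF limN tendsto_Re[OF lim]] c[OF FG] by blast
    ultimately show ?thesis ..
  qed
  then show ?thesis
    unfolding semibounded_below_def by blast
qed


section \<open>A single cell\<close>

text \<open>The difference \<open>\<phi>\<close> between the indefinite integral and
  \<open>h\<close> is constant inside the interval and continuous up to its ends, so it is constant
  throughout. This is needed because absolute continuity is known only on compact subintervals of an
  open cell.\<close>

lemma has_integral_interior_imp:
  fixes g h :: "real \<Rightarrow> 'a::banach"
  assumes "a < c" and g: "g integrable_on {a..c}" and h: "continuous_on {a..c} h"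
    and inner: "\<And>u v. \<lbrakk>a < u; u \<le> v; v < c\<rbrakk> \<Longrightarrow> (g has_integral h v - h u) {u..v}"
  shows "(g has_integral h c - h a) {a..c}"
proof -
  define \<phi> where "\<phi> = (\<lambda>t. integral {a..t} g - h t)"
  define m where "m = (a + c) / 2"
  have m: "a < m" "m < c"
    using \<open>a < c\<close> by (auto simp: m_def)
  have step: "\<phi> v = \<phi> u" if "a < u" "u \<le> v" "v < c" for u v
  proof -
    have "integral {a..u} g + integral {u..v} g = integral {a..v} g"
      using that by (intro Henstock_Kurzweil_Integration.integral_combine integrable_on_subinterval[OF g]) auto
    moreover have "integral {u..v} g = h v - h u"
      using inner[OF that] by (rule integral_unique)
    ultimately show ?thesis
      by (simp add: \<phi>_def algebra_simps)
  qed
  have const: "\<phi> t = \<phi> m" if "t \<in> {a<..<c}" for t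
    using that m step[of t m] step[of m t] by (cases "t \<le> m") auto
  have "continuous_on (closure {a<..<c}) \<phi>"
    using \<open>a < c\<close> indefinite_integral_continuous_1[OF g] h
    by (auto simp: \<phi>_def intro: continuous_on_diff)
  then have "\<phi> t = \<phi> m" if "t \<in> {a..c}" for t
    using continuous_constant_on_closure[of "{a<..<c}" \<phi> "\<phi> m" t] const that \<open>a < c\<close> by auto
  then have "\<phi> c = \<phi> a"
    using \<open>a < c\<close> by auto
  then have "integral {a..c} g = h c - h a"
    by (simp add: \<phi>_def algebra_simps)
  with g show ?thesis
    by (metis integrable_integral)
qed

text \<open>
  The derivative of \<open>(t - s) \<bar>f t\<bar>\<^sup>2\<close> is \<open>\<bar>f\<bar>\<^sup>2 + 2 (t - s) f \<bullet> f'\<close>; taking \<open>s = a\<close> or \<open>s = c\<close> makes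
  one boundary term disappear.
\<close>

lemma trace_inequality:
  fixes f f' :: "real \<Rightarrow> 'a::euclidean_space"
  assumes "a < c" and f: "continuous_on {a..c} f" and f': "continuous_on {a..c} f'"
    and df: "\<And>t. t \<in> {a<..<c} \<Longrightarrow> (f has_vector_derivative f' t) (at t)"
    and "\<eta> > 0" and z: "z \<in> {a, c}"
  shows "(c - a) * (norm (f z))\<^sup>2
      \<le> (1 + (c - a)\<^sup>2 / \<eta>) * integral {a..c} (\<lambda>t. (norm (f t))\<^sup>2) + \<eta> * integral {a..c} (\<lambda>t. (norm (f' t))\<^sup>2)"
proof -
  \<comment> \<open>The endpoint opposite to \<open>z\<close>, so that only the boundary term at
    \<open>z\<close> survives.\<close>
  define s where "s = (if z = a then c else a)"
  define d where "d = c - a"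
  define h where "h = (\<lambda>t. (t - s) * (f t \<bullet> f t))"
  define g where "g = (\<lambda>t. f t \<bullet> f t + (t - s) * (2 * (f t \<bullet> f' t)))"
  have "d > 0" using \<open>a < c\<close> by (simp add: d_def)
  have int: "(\<lambda>t. (norm (f t))\<^sup>2) integrable_on {a..c}" "(\<lambda>t. (norm (f' t))\<^sup>2) integrable_on {a..c}"
    using f f' by (auto intro!: integrable_continuous_interval continuous_intros)
  have "(g has_integral h c - h a) {a..c}"
  proof (rule fundamental_theorem_of_calculus_interior)
    show "continuous_on {a..c} h"
      unfolding h_def by (intro continuous_intros f)
    fix t assume t: "t \<in> {a<..<c}"
    have "((\<lambda>t. f t \<bullet> f t) has_vector_derivative (f t \<bullet> f' t + f' t \<bullet> f t)) (at t)"
      using df[OF t] by (intro bounded_bilinear.has_vector_derivative[OF bounded_bilinear_inner])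
    then have "((\<lambda>t. f t \<bullet> f t) has_real_derivative (2 * (f t \<bullet> f' t))) (at t)"
      by (simp add: has_real_derivative_iff_has_vector_derivative inner_commute)
    then have "(h has_real_derivative g t) (at t)"
      unfolding h_def g_def by (auto intro!: derivative_eq_intros)
    then show "(h has_vector_derivative g t) (at t)"
      by (simp add: has_real_derivative_iff_has_vector_derivative)
  qed (use \<open>a < c\<close> in simp)
  moreover have "h c - h a = d * (norm (f z))\<^sup>2"
    using z \<open>a < c\<close> by (auto simp: h_def s_def d_def power2_norm_eq_inner algebra_simps)
  ultimately have hi: "(g has_integral d * (norm (f z))\<^sup>2) {a..c}"
    by simp
  have hb: "((\<lambda>t. (1 + d\<^sup>2 / \<eta>) * (norm (f t))\<^sup>2 + \<eta> * (norm (f' t))\<^sup>2) has_integral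
      (1 + d\<^sup>2 / \<eta>) * integral {a..c} (\<lambda>t. (norm (f t))\<^sup>2) + \<eta> * integral {a..c} (\<lambda>t. (norm (f' t))\<^sup>2)) {a..c}"
    using int by (intro has_integral_add has_integral_mult_right) auto
  have "g t \<le> (1 + d\<^sup>2 / \<eta>) * (norm (f t))\<^sup>2 + \<eta> * (norm (f' t))\<^sup>2" if t: "t \<in> {a..c}" for t
  proof -
    have "\<bar>t - s\<bar> \<le> d"
      using t z by (auto simp: s_def d_def)
    then have "\<bar>(t - s) * (2 * (f t \<bullet> f' t))\<bar> \<le> d * (2 * (norm (f t) * norm (f' t)))"
      unfolding abs_mult using \<open>d > 0\<close> Cauchy_Schwarz_ineq2[of "f t" "f' t"]
      by (intro mult_mono) auto
    also have "\<dots> \<le> d\<^sup>2 / \<eta> * (norm (f t))\<^sup>2 + \<eta> * (norm (f' t))\<^sup>2"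
    proof -
      have "0 \<le> (d * norm (f t) - \<eta> * norm (f' t))\<^sup>2 / \<eta>"
        using \<open>\<eta> > 0\<close> by simp
      also have "\<dots> = d\<^sup>2 / \<eta> * (norm (f t))\<^sup>2 + \<eta> * (norm (f' t))\<^sup>2 - d * (2 * (norm (f t) * norm (f' t)))"
        using \<open>\<eta> > 0\<close> by (simp add: field_simps power2_eq_square)
      finally show ?thesis by simp
    qed
    finally show ?thesis
      by (simp add: g_def power2_norm_eq_inner algebra_simps)
  qed
  from has_integral_le[OF hi hb this] show ?thesis
    by (simp add: d_def)
qed

section \<open>Extending functions from an open cell to its closure\<close>

text \<open>Values at interaction points are arbitrary in \<open>W22\<close>. Replacing them by the
  one-sided limits gives a function continuous on the closed cell without changing it
  inside.\<close>

definition extend_limits :: "real \<Rightarrow> real \<Rightarrow> 'a \<Rightarrow> 'a \<Rightarrow> (real \<Rightarrow> 'a) \<Rightarrow> real \<Rightarrow> 'a" where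
  "extend_limits a c l r f = (\<lambda>t. if t \<le> a then l else if t \<ge> c then r else f t)"

lemma extend_limits_inside [simp]: "a < t \<Longrightarrow> t < c \<Longrightarrow> extend_limits a c l r f t = f t"
  by (simp add: extend_limits_def)

lemma extend_limits_left [simp]: "extend_limits a c l r f a = l"
  by (simp add: extend_limits_def)

lemma extend_limits_right [simp]: "a < c \<Longrightarrow> extend_limits a c l r f c = r"
  by (simp add: extend_limits_def)

lemma eventually_extend_limits:
  assumes "t \<in> {a<..<c}"
  shows "\<forall>\<^sub>F s in nhds t. extend_limits a c l r f s = f s"
  using eventually_nhds_in_open[of "{a<..<c}" t] assms by (auto elim!: eventually_mono)

lemma has_vector_derivative_extend_limits:
  assumes "t \<in> {a<..<c}"
  shows "(extend_limits a c l r f has_vector_derivative D) (at t) \<longleftrightarrow> (f has_vector_derivative D) (at t)"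
  using assms eventually_extend_limits[OF assms, of l r f]
  by (intro has_vector_derivative_cong_ev) (auto elim!: eventually_mono)

lemma continuous_on_extend_limits:
  fixes f :: "real \<Rightarrow> 'a::topological_space"
  assumes "a < c" and f: "\<And>t. t \<in> {a<..<c} \<Longrightarrow> isCont f t"
    and l: "(f \<longlongrightarrow> l) (at_right a)" and r: "(f \<longlongrightarrow> r) (at_left c)"
  shows "continuous_on {a..c} (extend_limits a c l r f)"
proof (rule continuous_on_IccI)
  show "(extend_limits a c l r f \<longlongrightarrow> extend_limits a c l r f a) (at_right a)"
    unfolding extend_limits_left
    by (rule Lim_transform_eventually[OF l])
      (use \<open>a < c\<close> in \<open>auto simp: eventually_at_right_field intro!: exI[of _ c]\<close>)
  show "(extend_limits a c l r f \<longlongrightarrow> extend_limits a c l r f c) (at_left c)"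
    unfolding extend_limits_right[OF \<open>a < c\<close>]
    by (rule Lim_transform_eventually[OF r])
      (use \<open>a < c\<close> in \<open>auto simp: eventually_at_left_field intro!: exI[of _ a]\<close>)
  fix t assume t: "a < t" "t < c"
  have "isCont (extend_limits a c l r f) t"
    using isCont_cong[OF eventually_extend_limits[of t a c l r f]] f[of t] t by auto
  then show "extend_limits a c l r f \<midarrow>t\<rightarrow> extend_limits a c l r f t"
    by (simp add: isCont_def)
qed (rule \<open>a < c\<close>)

lemma integral_extend_limits:
  "integral {a..c} (\<lambda>t. \<psi> (extend_limits a c l r f t)) = integral {a..c} (\<lambda>t. \<psi> (f t))"
  by (rule integral_spike[where S = "{a, c}"]) (auto simp: extend_limits_def)

text \<open>The Green formula integrates the derivative of \<open>f' * cnj f\<close>, which is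
  \<open>f'' * cnj f\<close> plus the squared modulus of \<open>f'\<close>; the one-sided limits
  give the boundary terms. It shares its hypotheses and the continuous extensions \<open>F\<close>,
  \<open>F'\<close> with the trace bound, hence the joint statement.\<close>

lemma cell_integration_by_parts:
  fixes f f' f'' :: "real \<Rightarrow> complex"
  assumes "a < c"
    and df: "\<And>t. t \<in> {a<..<c} \<Longrightarrow> (f has_vector_derivative f' t) (at t)"
    and acf: "\<And>u v. \<lbrakk>a < u; u \<le> v; v < c\<rbrakk> \<Longrightarrow> AC_on u v f"
    and acf': "\<And>u v. \<lbrakk>a < u; u \<le> v; v < c\<rbrakk> \<Longrightarrow> AC_on u v f'"
    and E: "negligible E"
    and df': "\<And>t. t \<in> {a<..<c} - E \<Longrightarrow> (f' has_vector_derivative f'' t) (at t)"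
    and lims: "(f \<longlongrightarrow> l) (at_right a)" "(f \<longlongrightarrow> r) (at_left c)"
      "(f' \<longlongrightarrow> p) (at_right a)" "(f' \<longlongrightarrow> m) (at_left c)"
    and int: "(\<lambda>t. f'' t * cnj (f t)) integrable_on {a..c}"
  shows cell_Green: "((\<lambda>t. f'' t * cnj (f t)) has_integral
      m * cnj r - p * cnj l - of_real (integral {a..c} (\<lambda>t. (cmod (f' t))\<^sup>2))) {a..c}"
    and cell_trace: "\<eta> > 0 \<Longrightarrow> z \<in> {l, r} \<Longrightarrow> (c - a) * (cmod z)\<^sup>2
      \<le> (1 + (c - a)\<^sup>2 / \<eta>) * integral {a..c} (\<lambda>t. (cmod (f t))\<^sup>2) + \<eta> * integral {a..c} (\<lambda>t. (cmod (f' t))\<^sup>2)"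
proof -
  have contf: "isCont f t" if "t \<in> {a<..<c}" for t
    using df[OF that] by (rule has_vector_derivative_continuous)
  \<comment> \<open>Since \<open>f'\<close> is differentiable only almost everywhere, its continuity
    is drawn from absolute continuity on a small interval around \<open>t\<close>.\<close>
  have contf': "isCont f' t" if "t \<in> {a<..<c}" for t
  proof -
    obtain u v where uv: "a < u" "u < t" "t < v" "v < c"
      using \<open>t \<in> {a<..<c}\<close> by (meson dense greaterThanLessThan_iff)
    then have "continuous_on {u..v} f'"
      by (intro AC_on_imp_continuous_on acf') auto
    then show ?thesis
      using uv continuous_on_interior[of "{u..v}" f' t] by simp
  qed
  define F F' where "F = extend_limits a c l r f" and "F' = extend_limits a c p m f'"
  have F: "continuous_on {a..c} F" and F': "continuous_on {a..c} F'"
    unfolding F_def F'_def using \<open>a < c\<close> lims contf contf' by (auto intro!: continuous_on_extend_limits)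
  have intF': "(\<lambda>t. (cmod (F' t))\<^sup>2) integrable_on {a..c}"
    using F' by (auto intro!: integrable_continuous_interval continuous_intros)
  have eq: "integral {a..c} (\<lambda>t. (cmod (F t))\<^sup>2) = integral {a..c} (\<lambda>t. (cmod (f t))\<^sup>2)"
    "integral {a..c} (\<lambda>t. (cmod (F' t))\<^sup>2) = integral {a..c} (\<lambda>t. (cmod (f' t))\<^sup>2)"
    unfolding F_def F'_def by (rule integral_extend_limits)+
  show "(c - a) * (cmod z)\<^sup>2
      \<le> (1 + (c - a)\<^sup>2 / \<eta>) * integral {a..c} (\<lambda>t. (cmod (f t))\<^sup>2) + \<eta> * integral {a..c} (\<lambda>t. (cmod (f' t))\<^sup>2)"
    if "\<eta> > 0" "z \<in> {l, r}"
  proof -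
    have "(F has_vector_derivative F' t) (at t)" if "t \<in> {a<..<c}" for t
      using df[OF that] that by (simp add: F_def F'_def has_vector_derivative_extend_limits)
    from trace_inequality[OF \<open>a < c\<close> F F' this \<open>\<eta> > 0\<close>, of a] trace_inequality[OF \<open>a < c\<close> F F' this \<open>\<eta> > 0\<close>, of c]
    show ?thesis
      using \<open>z \<in> {l, r}\<close> \<open>a < c\<close> unfolding eq by (auto simp: F_def)
  qed
  define h where "h = (\<lambda>t. F' t * cnj (F t))"
  define J where "J = integral {a..c} (\<lambda>t. (cmod (f' t))\<^sup>2)"
  \<comment> \<open>Almost everywhere in the cell this is the derivative of \<open>h\<close>.
    Writing \<open>F'\<close> in the second term makes that term continuous on the closed cell,
    hence integrable.\<close>
  define g where "g = (\<lambda>t. f'' t * cnj (f t) + of_real ((cmod (F' t))\<^sup>2))"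
  have J: "((\<lambda>t. complex_of_real ((cmod (F' t))\<^sup>2)) has_integral of_real J) {a..c}"
    using intF' eq(2) unfolding J_def by (metis has_integral_of_real integrable_integral)
  have "(g has_integral h c - h a) {a..c}"
  proof (rule has_integral_interior_imp[OF \<open>a < c\<close>])
    show "g integrable_on {a..c}"
      unfolding g_def using int J by (intro integrable_add) auto
    show "continuous_on {a..c} h"
      unfolding h_def by (intro continuous_intros F F')
    fix u v assume uv: "a < u" "u \<le> v" "v < c"
    have "(g has_integral (f' v * cnj (f v)) - (f' u * cnj (f u))) {u..v}"
    proof (rule AC_on_fundamental_theorem[OF _ _ E])
      show "AC_on u v (\<lambda>t. f' t * cnj (f t))"
        using uv by (intro AC_on_mult AC_on_cnj acf acf')
      fix t assume t: "t \<in> {u..v} - E"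
      then have t': "t \<in> {a<..<c}" "t \<in> {a<..<c} - E"
        using uv by auto
      have "((\<lambda>t. f' t * cnj (f t)) has_vector_derivative f' t * cnj (f' t) + f'' t * cnj (f t)) (at t)"
        using df[OF t'(1)] df'[OF t'(2)] by (intro has_vector_derivative_mult has_vector_derivative_cnj)
      moreover have "f' t * cnj (f' t) + f'' t * cnj (f t) = g t"
        using t' by (simp add: g_def F'_def complex_norm_square del: of_real_power)
      ultimately show "((\<lambda>t. f' t * cnj (f t)) has_vector_derivative g t) (at t within {u..v})"
        by (metis has_vector_derivative_at_within)
    qed (rule uv)
    then show "(g has_integral h v - h u) {u..v}"
      using uv by (simp add: h_def F_def F'_def)
  qed
  moreover have "h c - h a = m * cnj r - p * cnj l"
    using \<open>a < c\<close> by (simp add: h_def F_def F'_def)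
  ultimately have "((\<lambda>t. g t - of_real ((cmod (F' t))\<^sup>2)) has_integral m * cnj r - p * cnj l - of_real J) {a..c}"
    using J by (metis has_integral_diff)
  then show "((\<lambda>t. f'' t * cnj (f t)) has_integral
      m * cnj r - p * cnj l - of_real (integral {a..c} (\<lambda>t. (cmod (f' t))\<^sup>2))) {a..c}"
    unfolding J_def by (simp add: g_def)
qed


section \<open>The quadratic form of the minimal operator\<close>

lemma interval_I_lebesgue: "interval_I b \<in> sets lebesgue"
proof (cases b)
  case (real r)
  then have "interval_I b = {0..<r}" by (auto simp: interval_I_def)
  then show ?thesis by simp
next
  case PInf
  then have "interval_I b = {0..}" by (auto simp: interval_I_def)
  then show ?thesis by simp
next
  case MInf
  then have "interval_I b = {}" by (auto simp: interval_I_def)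
  then show ?thesis by simp
qed

lemma has_integral_strict_mono_partition:
  fixes \<phi> :: "real \<Rightarrow> 'a::banach"
  assumes "strict_mono x" and "\<And>n. n < M \<Longrightarrow> (\<phi> has_integral v n) {x n..x (Suc n)}"
  shows "(\<phi> has_integral (\<Sum>n<M. v n)) {x 0..x M}"
  using assms(2)
proof (induction M)
  case 0
  then show ?case
    using has_integral_null_real[of "x 0" "x 0" \<phi>] by simp
next
  case (Suc M)
  have "x 0 \<le> x M" "x M \<le> x (Suc M)"
    using \<open>strict_mono x\<close> by (simp_all add: strict_mono_less_eq)
  with Suc show ?case
    by (auto intro!: has_integral_combine[of "x 0" "x M" "x (Suc M)"])
qed

lemma cell_not_interaction_point:
  assumes "strict_mono x" "t \<in> {x n<..<x (Suc n)}"
  shows "t \<notin> interaction_points x"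
proof
  assume "t \<in> interaction_points x"
  then obtain k where "t = x k"
    by (auto simp: interaction_points_def)
  with assms have "n < k" "k < Suc n"
    by (auto simp: strict_mono_less)
  then show False by simp
qed

lemma minimal_graph_L2: "minimal_graph b x \<alpha> \<subseteq> L2 (interval_I b) \<times> L2 (interval_I b)"
  by (auto simp: minimal_graph_def W22_def L2_uminus)

text \<open>Reduces the form to finite sums: \<open>l n\<close> is the trace of \<open>f\<close> at
  \<open>x n\<close>, and \<open>N n\<close>, \<open>J n\<close> are the integrals of the squared
  moduli of \<open>f\<close> and \<open>f'\<close> over the cell from \<open>x n\<close> to
  \<open>x (Suc n)\<close>, whose length is \<open>gap x (Suc n)\<close>. Compact support leaves
  finitely many cells, and the boundary terms of neighbouring cells combine through the jump
  conditions.\<close>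

lemma minimal_graph_quadratic_form:
  assumes x: "x 0 = 0" "strict_mono x" and xb: "\<And>n. ereal (x n) < b" and lim: "(\<lambda>n. ereal (x n)) \<longlonglongrightarrow> b"
    and fg: "(f, g) \<in> minimal_graph b x \<alpha>"
  obtains M and l :: "nat \<Rightarrow> complex" and N J :: "nat \<Rightarrow> real"
  where "L2_inner (interval_I b) g f = of_real (\<Sum>n<M. \<alpha> (Suc n) * (cmod (l (Suc n)))\<^sup>2 + J n)"
    and "(L2_norm (interval_I b) f)\<^sup>2 = (\<Sum>n<M. N n)"
    and "l M = 0" and "\<And>n. N n \<ge> 0" and "\<And>n. J n \<ge> 0"
    and "\<And>n \<eta> z. \<lbrakk>\<eta> > 0; z \<in> {l n, l (Suc n)}\<rbrakk> \<Longrightarrow>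
           gap x (Suc n) * (cmod z)\<^sup>2 \<le> (1 + (gap x (Suc n))\<^sup>2 / \<eta>) * N n + \<eta> * J n"
proof -
  define I X where "I = interval_I b" and "X = interaction_points x"
  obtain f' f'' where W: "W22 I X f f' f''" and supp: "compact_support_in I X f"
    and f'0: "f' 0 = 0" and delta: "\<And>n. n \<ge> 1 \<Longrightarrow> delta_condition f f' (x n) (\<alpha> n)" and g: "g = (\<lambda>t. - f'' t)"
    using fg unfolding minimal_graph_def I_def X_def by blast
  have fL2: "f \<in> L2 I" and acf: "AC_loc (I - X) f" and acf': "AC_loc (I - X) f'" and f''L2: "f'' \<in> L2 I"
    and df: "\<And>t. t \<in> I - X \<Longrightarrow> (f has_vector_derivative f' t) (at t within (I - X))"
    and df': "AE t in lebesgue_on I. (f' has_vector_derivative f'' t) (at t within (I - X))"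
    using W unfolding W22_def by auto
  have I: "I \<in> sets lebesgue"
    by (simp add: I_def interval_I_lebesgue)
  have xlt: "x n < x (Suc n)" for n
    using x(2) by (simp add: strict_mono_less)
  have x0: "0 \<le> x n" for n
    using x strict_mono_less_eq[OF x(2), of 0 n] by simp
  have Isub: "{x n..x k} \<subseteq> I" for n k
  proof
    fix t assume "t \<in> {x n..x k}"
    then show "t \<in> I"
      using x0[of n] le_less_trans[OF _ xb[of k], of "ereal t"] by (auto simp: I_def interval_I_def)
  qed
  have cell: "{x n<..<x (Suc n)} \<subseteq> I - X" for n
    using Isub[of n "Suc n"] cell_not_interaction_point[OF x(2), of _ n] by (force simp: X_def)
  have at_cell: "at t within (I - X) = at t" if "t \<in> {x n<..<x (Suc n)}" for t n
    using that cell[of n] by (intro at_within_open_subset[of t "{x n<..<x (Suc n)}"]) auto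
  have X: "negligible X"
    by (simp add: X_def interaction_points_def negligible_iff_null_sets null_sets_completionI countable_imp_null_set_lborel)
  obtain E where E: "negligible E"
    and dfE: "\<And>t. t \<in> I - E \<Longrightarrow> (f' has_vector_derivative f'' t) (at t within (I - X))"
  proof -
    have "AE t in lebesgue. t \<in> I \<longrightarrow> (f' has_vector_derivative f'' t) (at t within (I - X))"
      using df' I by (simp add: AE_restrict_space_iff)
    then obtain E where "E \<in> null_sets lebesgue"
      "{t \<in> space lebesgue. \<not> (t \<in> I \<longrightarrow> (f' has_vector_derivative f'' t) (at t within (I - X)))} \<subseteq> E"
      by (auto simp: eventually_ae_filter)
    then show thesis
      by (intro that[of E]) (auto simp: negligible_iff_null_sets)
  qed
  obtain l0 p0 m where lpm: "\<And>n. n \<ge> 1 \<Longrightarrow> (f \<longlongrightarrow> l0 n) (at_right (x n)) \<and> (f \<longlongrightarrow> l0 n) (at_left (x n)) \<and>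
      (f' \<longlongrightarrow> p0 n) (at_right (x n)) \<and> (f' \<longlongrightarrow> m n) (at_left (x n)) \<and> p0 n - m n = of_real (\<alpha> n) * l0 n"
    using delta unfolding delta_condition_def by metis
  \<comment> \<open>Index 0 is the endpoint 0, not an interaction point. Storing \<open>f 0\<close>
    and \<open>f' 0\<close> there lets the first cell be treated like the others.\<close>
  define l p where "l = l0(0 := f 0)" and "p = p0(0 := f' 0)"
  have "0 \<notin> X"
  proof
    assume "0 \<in> X"
    then obtain k where "1 \<le> k" "x k = 0"
      by (auto simp: X_def interaction_points_def)
    then show False
      using strict_mono_less[OF x(2), of 0 k] x(1) by simp
  qed
  \<comment> \<open>As 0 lies in \<open>I - X\<close>, local absolute continuity reaches it and
    supplies the right-hand limits that the delta condition supplies at the interaction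
    points.\<close>
  have zero_right: "(f \<longlongrightarrow> f 0) (at_right 0)" "(f' \<longlongrightarrow> f' 0) (at_right 0)"
  proof -
    define v where "v = x 1 / 2"
    have v: "0 < v" "v < x 1"
      using xlt[of 0] x(1) by (auto simp: v_def)
    have sub: "{0..v} \<subseteq> I - X"
    proof
      fix t assume "t \<in> {0..v}"
      then show "t \<in> I - X"
        using v subsetD[OF cell[of 0], of t] \<open>0 \<notin> X\<close> x(1) Isub[of 0 1] by (cases "t = 0") auto
    qed
    then have "continuous_on {0..v} f" "continuous_on {0..v} f'"
      using acf acf' v unfolding AC_loc_def by (auto intro!: AC_on_imp_continuous_on)
    then have "(f \<longlongrightarrow> f 0) (at 0 within {0..v})" "(f' \<longlongrightarrow> f' 0) (at 0 within {0..v})"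
      using v by (auto simp: continuous_on)
    then show "(f \<longlongrightarrow> f 0) (at_right 0)" "(f' \<longlongrightarrow> f' 0) (at_right 0)"
      by (simp_all add: at_within_Icc_at_right[OF v(1)])
  qed
  have lims: "(f \<longlongrightarrow> l n) (at_right (x n))" "(f \<longlongrightarrow> l (Suc n)) (at_left (x (Suc n)))"
    "(f' \<longlongrightarrow> p n) (at_right (x n))" "(f' \<longlongrightarrow> m (Suc n)) (at_left (x (Suc n)))" for n
    using lpm[of n] lpm[of "Suc n"] zero_right x(1) by (auto simp: l_def p_def)
  have jump: "m (Suc n) = p (Suc n) - of_real (\<alpha> (Suc n)) * l (Suc n)" for n
    using lpm[of "Suc n"] by (simp add: l_def p_def algebra_simps)
  define \<phi> where "\<phi> = (\<lambda>t. f'' t * cnj (f t))"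
  have int\<phi>: "integrable (lebesgue_on I) \<phi>"
    unfolding \<phi>_def using L2_mult_cnj_integrable[OF f''L2 fL2] .
  have int_sub: "\<psi> integrable_on {x n..x k}" if "integrable (lebesgue_on I) \<psi>" for \<psi> :: "real \<Rightarrow> 'b::euclidean_space" and n k
  proof -
    have "set_integrable lebesgue I \<psi>"
      using that I by (simp add: set_integrable_def integrable_restrict_space)
    then have "set_integrable lebesgue {x n..x k} \<psi>"
      by (rule set_integrable_subset) (simp_all add: Isub)
    then show ?thesis
      by (simp add: absolutely_integrable_on_def)
  qed
  define N J where "N = (\<lambda>n. integral {x n..x (Suc n)} (\<lambda>t. (cmod (f t))\<^sup>2))"
    and "J = (\<lambda>n. integral {x n..x (Suc n)} (\<lambda>t. (cmod (f' t))\<^sup>2))"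
  have cell_facts: "(\<phi> has_integral m (Suc n) * cnj (l (Suc n)) - p n * cnj (l n) - of_real (J n)) {x n..x (Suc n)}"
    "\<lbrakk>\<eta> > 0; z \<in> {l n, l (Suc n)}\<rbrakk> \<Longrightarrow>
        (x (Suc n) - x n) * (cmod z)\<^sup>2 \<le> (1 + (x (Suc n) - x n)\<^sup>2 / \<eta>) * N n + \<eta> * J n" for n \<eta> z
  proof -
    have 1: "(f has_vector_derivative f' t) (at t)" if "t \<in> {x n<..<x (Suc n)}" for t
      using df[of t] cell[of n] at_cell[OF that] that by auto
    have 2: "AC_on u v f" "AC_on u v f'" if "x n < u" "u \<le> v" "v < x (Suc n)" for u v
    proof -
      have "{u..v} \<subseteq> {x n<..<x (Suc n)}"
        using that by auto
      then show "AC_on u v f" "AC_on u v f'"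
        using acf acf' cell[of n] that unfolding AC_loc_def by blast+
    qed
    have 3: "(f' has_vector_derivative f'' t) (at t)" if "t \<in> {x n<..<x (Suc n)} - E" for t
      using dfE[of t] cell[of n] at_cell[of t n] that by auto
    have 4: "(\<lambda>t. f'' t * cnj (f t)) integrable_on {x n..x (Suc n)}"
      using int_sub[OF int\<phi>] by (simp add: \<phi>_def)
    show "(\<phi> has_integral m (Suc n) * cnj (l (Suc n)) - p n * cnj (l n) - of_real (J n)) {x n..x (Suc n)}"
      unfolding \<phi>_def J_def by (rule cell_Green[OF xlt 1 2 E 3 lims 4])
    show "(x (Suc n) - x n) * (cmod z)\<^sup>2 \<le> (1 + (x (Suc n) - x n)\<^sup>2 / \<eta>) * N n + \<eta> * J n"
      if "\<eta> > 0" "z \<in> {l n, l (Suc n)}"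
      unfolding N_def J_def by (rule cell_trace[OF xlt 1 2 E 3 lims 4 that])
  qed
  \<comment> \<open>A nonempty support attains its maximum, which is below \<open>b\<close>; since
    \<open>x n\<close> tends to \<open>b\<close>, some \<open>x k\<close> lies beyond it.\<close>
  obtain k where k: "\<And>t. \<lbrakk>t \<in> I - X; t > x k\<rbrakk> \<Longrightarrow> f t = 0"
  proof -
    let ?S = "closure {t \<in> I - X. f t \<noteq> 0}"
    have S: "compact ?S" "?S \<subseteq> I"
      using supp unfolding compact_support_in_def by auto
    show thesis
    proof (cases "?S = {}")
      case True
      then show ?thesis
        using that[of 0] by (metis (mono_tags, lifting) closure_eq_empty empty_iff mem_Collect_eq)
    next
      case False
      then obtain s where s: "s \<in> ?S" "\<And>t. t \<in> ?S \<Longrightarrow> t \<le> s"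
        using compact_attains_sup[OF S(1)] by blast
      then have "ereal s < b"
        using S(2) by (auto simp: I_def interval_I_def)
      then have "\<forall>\<^sub>F n in sequentially. ereal s < ereal (x n)"
        using order_tendstoD(1)[OF lim] by blast
      then obtain k where "s < x k"
        by (auto simp: eventually_sequentially)
      then show ?thesis
        using that[of k] s(2) closure_subset[of "{t \<in> I - X. f t \<noteq> 0}"] by fastforce
    qed
  qed
  \<comment> \<open>One cell past \<open>x k\<close>: \<open>f\<close> vanishes on the whole last
    cell, which forces its left limit \<open>l M\<close> to be 0.\<close>
  define M where "M = Suc k"
  have outside: "f t = 0" if "t \<in> I - X - {0..x M}" for t
    using k[of t] xlt[of k] that by (auto simp: M_def I_def interval_I_def)
  have lM: "l M = 0"
  proof -
    have "\<forall>\<^sub>F t in at_left (x M). t \<in> {x k<..<x M}"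
      using xlt[of k] by (auto simp: M_def eventually_at_left_field)
    then have "\<forall>\<^sub>F t in at_left (x M). 0 = f t"
      by eventually_elim (use k cell[of k] in \<open>auto simp: M_def\<close>)
    then have "(f \<longlongrightarrow> 0) (at_left (x M))"
      using Lim_transform_eventually[OF tendsto_const] by blast
    then show ?thesis
      using lims(2)[of k] tendsto_unique trivial_limit_at_left_real unfolding M_def by blast
  qed
  \<comment> \<open>Turns a Lebesgue integral over \<open>I\<close> into a gauge integral over the
    first \<open>M\<close> cells. Beyond them the integrand can be nonzero only on the null set
    \<open>X\<close>.\<close>
  have restrict: "(LINT t|lebesgue_on I. \<psi> t) = y"
    if int: "integrable (lebesgue_on I) \<psi>" and y: "(\<psi> has_integral y) {x 0..x M}" and 0: "\<And>t. f t = 0 \<Longrightarrow> \<psi> t = 0"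
    for \<psi> :: "real \<Rightarrow> 'b::euclidean_space" and y
  proof -
    have "((\<lambda>t. if t \<in> {x 0..x M} then \<psi> t else 0) has_integral y) I"
      using y by (subst has_integral_restrict) (simp_all only: Isub)
    then have "(\<psi> has_integral y) I"
      by (rule has_integral_spike[OF X, rotated]) (use 0 outside x(1) in auto)
    then show ?thesis
      using lebesgue_integral_eq_integral[OF int I] by (simp add: integral_unique)
  qed
  have "(LINT t|lebesgue_on I. (cmod (f t))\<^sup>2) = (\<Sum>n<M. N n)"
  proof (rule restrict)
    show int: "integrable (lebesgue_on I) (\<lambda>t. (cmod (f t))\<^sup>2)"
      using fL2 by (simp add: L2_def)
    show "((\<lambda>t. (cmod (f t))\<^sup>2) has_integral (\<Sum>n<M. N n)) {x 0..x M}"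
      unfolding N_def using int_sub[OF int] x(2) by (intro has_integral_strict_mono_partition integrable_integral)
  qed simp
  then have norm: "(L2_norm I f)\<^sup>2 = (\<Sum>n<M. N n)"
    by (simp add: L2_norm_power2)
  let ?q = "\<lambda>n. p n * cnj (l n)"
  have "(LINT t|lebesgue_on I. \<phi> t) = (\<Sum>n<M. m (Suc n) * cnj (l (Suc n)) - ?q n - of_real (J n))"
    using int\<phi> by (rule restrict) (auto simp: \<phi>_def intro!: has_integral_strict_mono_partition[OF x(2)] cell_facts(1)[unfolded \<phi>_def])
  \<comment> \<open>Substituting the jump condition for \<open>m (Suc n)\<close> expresses the left
    boundary value through the right one, so the boundary terms telescope and only the interaction
    terms are left over.\<close>
  also have "\<dots> = (\<Sum>n<M. (?q (Suc n) - ?q n) - of_real (\<alpha> (Suc n) * (cmod (l (Suc n)))\<^sup>2 + J n))"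
    by (intro sum.cong refl) (simp add: jump complex_norm_square algebra_simps del: of_real_power)
  also have "\<dots> = ?q M - ?q 0 - of_real (\<Sum>n<M. \<alpha> (Suc n) * (cmod (l (Suc n)))\<^sup>2 + J n)"
    unfolding sum_subtractf[of "\<lambda>n. ?q (Suc n) - ?q n"] of_real_sum
    using sum_lessThan_telescope[of ?q M] by simp
  \<comment> \<open>The end terms vanish: at \<open>M\<close> because \<open>l M = 0\<close>, at 0
    by the Neumann condition \<open>f' 0 = 0\<close>.\<close>
  also have "\<dots> = - of_real (\<Sum>n<M. \<alpha> (Suc n) * (cmod (l (Suc n)))\<^sup>2 + J n)"
    by (simp add: lM p_def f'0)
  finally have "L2_inner I g f = of_real (\<Sum>n<M. \<alpha> (Suc n) * (cmod (l (Suc n)))\<^sup>2 + J n)"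
    by (simp add: L2_inner_def g \<phi>_def)
  \<comment> \<open>A nonintegrable function has integral 0 by convention, which settles that
    case.\<close>
  moreover have "N n \<ge> 0" "J n \<ge> 0" for n
    unfolding N_def J_def
    by (metis Henstock_Kurzweil_Integration.integral_nonneg not_integrable_integral order_refl zero_le_power2)+
  ultimately show thesis
    using norm lM cell_facts(2) by (intro that[where M = M and l = l and N = N and J = J]) (auto simp: I_def gap_def)
qed

section \<open>Lower bound for the quadratic form\<close>

text \<open>Indices are shifted: \<open>d n\<close> is the length of cell \<open>n\<close>, and
  \<open>\<alpha> n\<close> acts at its right end. The weight \<open>d n + d (Suc n)\<close> charges
  each interaction to its two adjacent cells, where the trace bound applies. Each cell is charged at
  most twice, so the total derivative cost is at most \<open>2 * C * \<eta>\<close> times the sum of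
  the \<open>J n\<close>.\<close>

lemma delta_sum_lower_bound:
  fixes l :: "nat \<Rightarrow> complex" and \<alpha> d N J :: "nat \<Rightarrow> real"
  assumes d: "\<And>n. 0 < d n" "\<And>n. d n \<le> D" and "C \<ge> 0"
    and \<alpha>: "\<And>n. \<alpha> n \<ge> - C * (d n + d (Suc n))"
    and NJ: "\<And>n. N n \<ge> 0" "\<And>n. J n \<ge> 0" and lM: "l M = 0"
    and trace: "\<And>n \<eta> z. \<lbrakk>\<eta> > 0; z \<in> {l n, l (Suc n)}\<rbrakk> \<Longrightarrow>
           d n * (cmod z)\<^sup>2 \<le> (1 + (d n)\<^sup>2 / \<eta>) * N n + \<eta> * J n"
  shows "(\<Sum>n<M. \<alpha> n * (cmod (l (Suc n)))\<^sup>2 + J n)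
      \<ge> - (2 * C * (1 + D\<^sup>2 * (2 * C + 1))) * (\<Sum>n<M. N n)"
proof -
  \<comment> \<open>Chosen so that \<open>2 * C * \<eta>\<close> is at most 1, with the summand 1
    covering \<open>C = 0\<close>. Then \<open>K\<close> bounds the factor of \<open>N n\<close> in
    the trace bound uniformly in \<open>n\<close>.\<close>
  define \<eta> where "\<eta> = 1 / (2 * C + 1)"
  define K where "K = 1 + D\<^sup>2 * (2 * C + 1)"
  define S where "S = (\<lambda>n. K * N n + \<eta> * J n)"
  have \<eta>: "\<eta> > 0" "2 * C * \<eta> \<le> 1"
    using \<open>C \<ge> 0\<close> by (auto simp: \<eta>_def field_simps)
  have "K \<ge> 0"
    using \<open>C \<ge> 0\<close> by (simp add: K_def)
  have S: "S n \<ge> 0" for n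
    using NJ \<eta> \<open>K \<ge> 0\<close> by (simp add: S_def)
  have tr: "d n * (cmod z)\<^sup>2 \<le> S n" if "z \<in> {l n, l (Suc n)}" for n z
  proof -
    have "(d n)\<^sup>2 \<le> D\<^sup>2"
      using d[of n] by (intro power_mono) auto
    then have "1 + (d n)\<^sup>2 / \<eta> \<le> K"
      using \<eta> \<open>C \<ge> 0\<close> by (simp add: K_def \<eta>_def mult_right_mono)
    then have "(1 + (d n)\<^sup>2 / \<eta>) * N n \<le> K * N n"
      using NJ(1) by (rule mult_right_mono)
    then show ?thesis
      using trace[OF \<eta>(1) that] by (simp add: S_def)
  qed
  have left: "(\<Sum>n<M. d n * (cmod (l (Suc n)))\<^sup>2) \<le> (\<Sum>n<M. S n)"
    by (intro sum_mono tr) simp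
  \<comment> \<open>The right-hand cell of the last point would have index \<open>M\<close>, outside
    the sum, but that term vanishes with \<open>l M\<close>. The shifted sum then omits only
    \<open>S 0\<close>, which is nonnegative.\<close>
  have right: "(\<Sum>n<M. d (Suc n) * (cmod (l (Suc n)))\<^sup>2) \<le> (\<Sum>n<M. S n)"
  proof (cases M)
    case (Suc k)
    have "(\<Sum>n<M. d (Suc n) * (cmod (l (Suc n)))\<^sup>2) = (\<Sum>n<k. d (Suc n) * (cmod (l (Suc n)))\<^sup>2)"
      using lM Suc by simp
    also have "\<dots> \<le> (\<Sum>n<k. S (Suc n))"
      by (intro sum_mono tr) simp
    also have "\<dots> \<le> (\<Sum>n<M. S n)"
      using S[of 0] by (simp only: Suc sum.lessThan_Suc_shift)
    finally show ?thesis .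
  qed simp
  have "(\<Sum>n<M. \<alpha> n * (cmod (l (Suc n)))\<^sup>2)
      \<ge> (\<Sum>n<M. - C * (d n + d (Suc n)) * (cmod (l (Suc n)))\<^sup>2)"
    by (intro sum_mono mult_right_mono \<alpha>) simp
  moreover have "(\<Sum>n<M. - C * (d n + d (Suc n)) * (cmod (l (Suc n)))\<^sup>2)
      = - C * ((\<Sum>n<M. d n * (cmod (l (Suc n)))\<^sup>2) + (\<Sum>n<M. d (Suc n) * (cmod (l (Suc n)))\<^sup>2))"
    by (simp add: sum_distrib_left algebra_simps flip: sum.distrib)
  moreover have "C * ((\<Sum>n<M. d n * (cmod (l (Suc n)))\<^sup>2) + (\<Sum>n<M. d (Suc n) * (cmod (l (Suc n)))\<^sup>2))
      \<le> C * (2 * (\<Sum>n<M. S n))"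
    using left right \<open>C \<ge> 0\<close> by (intro mult_left_mono) auto
  moreover have "C * (2 * (\<Sum>n<M. S n)) = 2 * C * K * (\<Sum>n<M. N n) + (2 * C * \<eta>) * (\<Sum>n<M. J n)"
    by (simp add: S_def sum.distrib algebra_simps flip: sum_distrib_left)
  \<comment> \<open>The derivative cost is absorbed by the sum of the \<open>J n\<close> already
    present in the form.\<close>
  moreover have "(2 * C * \<eta>) * (\<Sum>n<M. J n) \<le> 1 * (\<Sum>n<M. J n)"
    using \<eta>(2) NJ(2) by (intro mult_right_mono sum_nonneg) auto
  ultimately show ?thesis
    by (simp add: K_def sum.distrib)
qed

theorem corollary5p26:
  fixes b :: ereal and x \<alpha> :: "nat \<Rightarrow> real"
  assumes "0 < b"
    and "x 0 = 0" and "strict_mono x" and "\<And>n. ereal (x n) < b"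
    and "(\<lambda>n. ereal (x n)) \<longlonglongrightarrow> b"
    and "(SUP n\<in>{1..}. ereal (gap x n)) < \<infinity>"
    and "(INF n\<in>{1..}. ereal (\<alpha> n / (gap x n + gap x (n + 1)))) > -\<infinity>"
  shows "semibounded_below (interval_I b) (Hamiltonian b x \<alpha>)"
proof -
  have gap: "0 < gap x (Suc n)" for n
    using \<open>strict_mono x\<close> by (simp add: gap_def strict_mono_less)
  \<comment> \<open>The supremum and infimum are extended reals; density provides real numbers
    \<open>D\<close> above the first and \<open>r\<close> below the second.\<close>
  obtain D where "(SUP n\<in>{1..}. ereal (gap x n)) < ereal D"
    using ereal_dense2[OF assms(6)] by blast
  then have D: "gap x (Suc n) \<le> D" for n
    using SUP_lessD[of "\<lambda>n. ereal (gap x n)" "{1..}" "ereal D" "Suc n"] by simp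
  obtain r where r: "ereal r < (INF n\<in>{1..}. ereal (\<alpha> n / (gap x n + gap x (n + 1))))"
    using ereal_dense2[OF assms(7)] by blast
  \<comment> \<open>The absolute value ensures both \<open>C \<ge> 0\<close> and
    \<open>- C \<le> r\<close>.\<close>
  define C where "C = \<bar>r\<bar>"
  have \<alpha>: "\<alpha> (Suc n) \<ge> - C * (gap x (Suc n) + gap x (Suc (Suc n)))" for n
  proof -
    have "- C \<le> \<alpha> (Suc n) / (gap x (Suc n) + gap x (Suc (Suc n)))"
      using less_INF_D[OF r, of "Suc n"] by (simp add: C_def)
    then show ?thesis
      using gap[of n] gap[of "Suc n"] by (simp add: pos_le_divide_eq add_pos_pos)
  qed
  \<comment> \<open>Built from \<open>C\<close> and \<open>D\<close> alone, so one constant serves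
    every element of the graph.\<close>
  define c where "c = - (2 * C * (1 + D\<^sup>2 * (2 * C + 1)))"
  have "L2_inner (interval_I b) g f \<in> \<real> \<and> c * (L2_norm (interval_I b) f)\<^sup>2 \<le> Re (L2_inner (interval_I b) g f)"
    if fg: "(f, g) \<in> minimal_graph b x \<alpha>" for f g
  proof (rule minimal_graph_quadratic_form[OF assms(2-5) fg])
    fix M and l :: "nat \<Rightarrow> complex" and N J :: "nat \<Rightarrow> real"
    assume form: "L2_inner (interval_I b) g f = of_real (\<Sum>n<M. \<alpha> (Suc n) * (cmod (l (Suc n)))\<^sup>2 + J n)"
      and norm: "(L2_norm (interval_I b) f)\<^sup>2 = (\<Sum>n<M. N n)"
      and bound: "l M = 0" "\<And>n. N n \<ge> 0" "\<And>n. J n \<ge> 0"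
        "\<And>n \<eta> z. \<lbrakk>\<eta> > 0; z \<in> {l n, l (Suc n)}\<rbrakk> \<Longrightarrow>
           gap x (Suc n) * (cmod z)\<^sup>2 \<le> (1 + (gap x (Suc n))\<^sup>2 / \<eta>) * N n + \<eta> * J n"
    have "(\<Sum>n<M. \<alpha> (Suc n) * (cmod (l (Suc n)))\<^sup>2 + J n) \<ge> c * (\<Sum>n<M. N n)"
      unfolding c_def
      by (rule delta_sum_lower_bound[of "\<lambda>n. gap x (Suc n)" D C "\<lambda>n. \<alpha> (Suc n)" N J l M, OF gap D _ \<alpha> bound(2,3,1,4)])
        (simp_all add: C_def)
    then show "L2_inner (interval_I b) g f \<in> \<real> \<and> c * (L2_norm (interval_I b) f)\<^sup>2 \<le> Re (L2_inner (interval_I b) g f)"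
      by (simp only: form norm Re_complex_of_real Reals_of_real)
  qed
  then have "semibounded_below (interval_I b) (minimal_graph b x \<alpha>)"
    unfolding semibounded_below_def by blast
  then show ?thesis
    unfolding Hamiltonian_def by (rule semibounded_below_graph_closure[OF minimal_graph_L2])
qed

end
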